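(* Every central symmetric ring is $P$-symmetric.
   Context: Rings are associative with identity (not necessarily commutative). $Z(R)$ denotes the center of a ring $R$, and $P(R)$ its prime radical (the intersection of all prime two-sided ideals of $R$; equivalently the set of all strongly nilpotent elements of $R$). A ring $R$ is central symmetric if for any $a,b,c\in R$, $abc=0$ implies $bac\in Z(R)$. A ring $R$ is $P$-symmetric if for any $a,b,c\in R$, $abc=0$ implies $bac\in P(R)$. *)

theory Defs
  imports "HOL-Algebra.Ideal_Product"
begin

definition ring_center :: "('a, 'b) ring_scheme \<Rightarrow> 'a set"
  where "ring_center R =
    {z \<in> carrier R. \<forall>x \<in> carrier R. z \<otimes>\<^bsub>R\<^esub> x = x \<otimes>\<^bsub>R\<^esub> z}"

text \<open>
  The library locale \<open>primeideal\<close> presupposes a commutative ring and is elementwise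
  (completely prime). In a noncommutative ring, a prime ideal is a proper two-sided ideal that
  contains a product of two two-sided ideals only if it contains one of the factors.
  The library predicate \<open>ideal\<close> means a two-sided ideal.
\<close>

definition nc_prime_ideal :: "'a set \<Rightarrow> ('a, 'b) ring_scheme \<Rightarrow> bool"
  where "nc_prime_ideal P R \<longleftrightarrow>
    ideal P R \<and> P \<noteq> carrier R \<and>
    (\<forall>I J. ideal I R \<longrightarrow> ideal J R \<longrightarrow> I \<cdot>\<^bsub>R\<^esub> J \<subseteq> P \<longrightarrow> I \<subseteq> P \<or> J \<subseteq> P)"

text \<open>
  The intersection is taken inside the carrier, so that the zero ring, which has no prime ideals,
  is its own prime radical.
\<close>

definition prime_radical :: "('a, 'b) ring_scheme \<Rightarrow> 'a set"
  where "prime_radical R = carrier R \<inter> \<Inter> {P. nc_prime_ideal P R}"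

definition central_symmetric :: "('a, 'b) ring_scheme \<Rightarrow> bool"
  where "central_symmetric R \<longleftrightarrow>
    (\<forall>a \<in> carrier R. \<forall>b \<in> carrier R. \<forall>c \<in> carrier R.
      a \<otimes>\<^bsub>R\<^esub> b \<otimes>\<^bsub>R\<^esub> c = \<zero>\<^bsub>R\<^esub> \<longrightarrow> b \<otimes>\<^bsub>R\<^esub> a \<otimes>\<^bsub>R\<^esub> c \<in> ring_center R)"

definition P_symmetric :: "('a, 'b) ring_scheme \<Rightarrow> bool"
  where "P_symmetric R \<longleftrightarrow>
    (\<forall>a \<in> carrier R. \<forall>b \<in> carrier R. \<forall>c \<in> carrier R.
      a \<otimes>\<^bsub>R\<^esub> b \<otimes>\<^bsub>R\<^esub> c = \<zero>\<^bsub>R\<^esub> \<longrightarrow> b \<otimes>\<^bsub>R\<^esub> a \<otimes>\<^bsub>R\<^esub> c \<in> prime_radical R)"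

end

theory Submission
  imports Defs
begin

text \<open>
  Let \<open>abc = 0\<close> and \<open>z = bac\<close>. For every \<open>r\<close> also \<open>ab(cr) = 0\<close>, so the whole of \<open>zR\<close> is
  central. Then \<open>z r s = s z r = z s r\<close>, i.e. \<open>z\<close> annihilates all commutators, and
  \<open>z\<^sup>2 = z(ba)c = z(ab)c = 0\<close>. A central element of square zero lies in every prime ideal,
  because the ideal \<open>Rz\<close> has square zero.
\<close>

lemma ring_centerD:
  assumes "z \<in> ring_center R"
  shows "z \<in> carrier R" "\<And>x. x \<in> carrier R \<Longrightarrow> z \<otimes>\<^bsub>R\<^esub> x = x \<otimes>\<^bsub>R\<^esub> z"
  using assms by (auto simp: ring_center_def)

context ring
begin

text \<open>\<open>PIdl z\<close> is the set of all products \<open>r \<otimes> z\<close>, in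
  general only a left ideal. Centrality of \<open>z\<close> gives absorption on the right, since
  \<open>s \<otimes> z \<otimes> r = s \<otimes> r \<otimes> z\<close>.\<close>

lemma cgenideal_ideal_center:
  assumes "z \<in> ring_center R"
  shows "ideal (PIdl z) R"
proof -
  note z = ring_centerD[OF assms]
  show ?thesis
  proof (rule idealI)
    show "ring R" by (rule ring_axioms)
    show "subgroup (PIdl z) (add_monoid R)"
    proof (rule group.subgroupI[OF add.is_group])
      show "PIdl z \<subseteq> carrier (add_monoid R)" "PIdl z \<noteq> {}"
        using z(1) by (auto simp: cgenideal_def)
    next
      fix x assume "x \<in> PIdl z"
      then obtain r where r: "r \<in> carrier R" "x = r \<otimes> z"
        by (auto simp: cgenideal_def)
      then have "inv\<^bsub>add_monoid R\<^esub> x = (\<ominus> r) \<otimes> z"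
        using z(1) by (simp add: a_inv_def[symmetric] l_minus)
      then show "inv\<^bsub>add_monoid R\<^esub> x \<in> PIdl z"
        using r(1) by (auto simp: cgenideal_def)
    next
      fix x y assume "x \<in> PIdl z" "y \<in> PIdl z"
      then obtain r s where rs: "r \<in> carrier R" "x = r \<otimes> z" "s \<in> carrier R" "y = s \<otimes> z"
        by (auto simp: cgenideal_def)
      then have "x \<oplus> y = (r \<oplus> s) \<otimes> z"
        using z(1) by (simp add: l_distr)
      then show "x \<otimes>\<^bsub>add_monoid R\<^esub> y \<in> PIdl z"
        using rs by (auto simp: cgenideal_def)
    qed
  next
    fix x r assume "x \<in> PIdl z" and r: "r \<in> carrier R"
    then obtain s where s: "s \<in> carrier R" "x = s \<otimes> z"
      by (auto simp: cgenideal_def)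
    have "r \<otimes> x = (r \<otimes> s) \<otimes> z" "x \<otimes> r = (s \<otimes> r) \<otimes> z"
      using r s z(1) by (simp_all add: z(2)[OF r] m_assoc)
    then show "r \<otimes> x \<in> PIdl z" "x \<otimes> r \<in> PIdl z"
      using r s by (auto simp: cgenideal_def)
  qed
qed

lemma square_zero_center_in_prime_ideal:
  assumes z: "z \<in> ring_center R" and sq: "z \<otimes> z = \<zero>" and P: "nc_prime_ideal P R"
  shows "z \<in> P"
proof -
  note zc = ring_centerD[OF z]
  interpret P: ideal P R using P by (simp add: nc_prime_ideal_def)
  have "(PIdl z) \<cdot> (PIdl z) \<subseteq> P"
  proof
    fix x assume "x \<in> (PIdl z) \<cdot> (PIdl z)"
    then show "x \<in> P"
    \<comment> \<open>The ideal product is generated inductively by products and sums. Only products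
      need an argument; sums stay in \<open>P\<close> by additive closure and are left to the
      closing \<open>simp\<close>.\<close>
    proof (induction rule: ideal_prod.induct)
      case (prod i j)
      then obtain r s where rs: "r \<in> carrier R" "i = r \<otimes> z" "s \<in> carrier R" "j = s \<otimes> z"
        by (auto simp: cgenideal_def)
      have "i \<otimes> j = r \<otimes> (z \<otimes> s) \<otimes> z"
        using rs zc(1) by (simp add: m_assoc)
      \<comment> \<open>Centrality moves the inner \<open>z\<close> past \<open>s\<close>, which
        brings the two copies of \<open>z\<close> together.\<close>
      also have "\<dots> = (r \<otimes> s) \<otimes> (z \<otimes> z)"
        using rs(1,3) zc(1) by (simp add: zc(2)[OF rs(3)] m_assoc)
      finally have "i \<otimes> j = \<zero>" using rs sq by simp
      then show ?case by simp
    qed simp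
  qed
  then have "PIdl z \<subseteq> P"
    using P cgenideal_ideal_center[OF z] by (auto simp: nc_prime_ideal_def)
  moreover have "z \<in> PIdl z"
    using zc(1) l_one[of z, symmetric] unfolding cgenideal_def by blast
  ultimately show ?thesis by blast
qed

text \<open>Centrality of \<open>z\<close> alone would not suffice, as \<open>z = \<one>\<close>
  shows: \<open>s\<close> has to commute both with \<open>z\<close> and with
  \<open>z \<otimes> r\<close>, and comparing the two relations swaps \<open>r\<close> and
  \<open>s\<close> behind \<open>z\<close>.\<close>

lemma central_right_ideal_mult_commute:
  assumes "\<And>r. r \<in> carrier R \<Longrightarrow> z \<otimes> r \<in> ring_center R"
    and "z \<in> carrier R" "r \<in> carrier R" "s \<in> carrier R"
  shows "z \<otimes> (r \<otimes> s) = z \<otimes> (s \<otimes> r)"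
proof -
  have "z \<in> ring_center R" using assms(1)[of \<one>] assms(2) by simp
  then have "z \<otimes> s = s \<otimes> z" using assms(4) by (rule ring_centerD)
  moreover have "z \<otimes> r \<otimes> s = s \<otimes> (z \<otimes> r)"
    using assms by (blast intro: ring_centerD)
  ultimately show ?thesis using assms(2-4) by (simp add: m_assoc[symmetric])
qed

end

theorem theorem2p7:
  fixes R :: "('a, 'b) ring_scheme"
  assumes "ring R" and "central_symmetric R"
  shows "P_symmetric R"
proof -
  interpret ring R by fact
  show ?thesis
    unfolding P_symmetric_def
  proof (intro ballI impI)
    fix a b c
    assume abc: "a \<in> carrier R" "b \<in> carrier R" "c \<in> carrier R"
      and zero: "a \<otimes>\<^bsub>R\<^esub> b \<otimes>\<^bsub>R\<^esub> c = \<zero>\<^bsub>R\<^esub>"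
    define z where "z = b \<otimes>\<^bsub>R\<^esub> a \<otimes>\<^bsub>R\<^esub> c"
    have zR: "z \<in> carrier R" using abc by (simp add: z_def)
    have central: "z \<otimes>\<^bsub>R\<^esub> r \<in> ring_center R" if r: "r \<in> carrier R" for r
    proof -
      have "a \<otimes>\<^bsub>R\<^esub> b \<otimes>\<^bsub>R\<^esub> (c \<otimes>\<^bsub>R\<^esub> r) = a \<otimes>\<^bsub>R\<^esub> b \<otimes>\<^bsub>R\<^esub> c \<otimes>\<^bsub>R\<^esub> r"
        using abc r by (simp add: m_assoc)
      then have "a \<otimes>\<^bsub>R\<^esub> b \<otimes>\<^bsub>R\<^esub> (c \<otimes>\<^bsub>R\<^esub> r) = \<zero>\<^bsub>R\<^esub>"
        using zero r by simp
      then have "b \<otimes>\<^bsub>R\<^esub> a \<otimes>\<^bsub>R\<^esub> (c \<otimes>\<^bsub>R\<^esub> r) \<in> ring_center R"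
        using assms(2) abc r by (simp add: central_symmetric_def)
      then show ?thesis using abc r by (simp add: z_def m_assoc)
    qed
    have "z \<otimes>\<^bsub>R\<^esub> z = z \<otimes>\<^bsub>R\<^esub> (b \<otimes>\<^bsub>R\<^esub> a) \<otimes>\<^bsub>R\<^esub> c"
      \<comment> \<open>Only the second factor is unfolded; the first stays as \<open>z\<close>, so
        that \<open>b\<close> and \<open>a\<close> can be swapped behind it.\<close>
      using abc zR by (subst (2) z_def) (simp add: m_assoc)
    also have "\<dots> = z \<otimes>\<^bsub>R\<^esub> (a \<otimes>\<^bsub>R\<^esub> b) \<otimes>\<^bsub>R\<^esub> c"
      \<comment> \<open>The swap is taken with \<open>b\<close> for \<open>r\<close> and
        \<open>a\<close> for \<open>s\<close>, which makes the vanishing product of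
        \<open>a\<close>, \<open>b\<close>, \<open>c\<close> appear.\<close>
      using central_right_ideal_mult_commute[OF central zR abc(2,1)] by simp
    also have "\<dots> = z \<otimes>\<^bsub>R\<^esub> (a \<otimes>\<^bsub>R\<^esub> b \<otimes>\<^bsub>R\<^esub> c)"
      using abc zR by (simp add: m_assoc)
    also have "\<dots> = \<zero>\<^bsub>R\<^esub>" using zero zR by simp
    finally have "z \<otimes>\<^bsub>R\<^esub> z = \<zero>\<^bsub>R\<^esub>" .
    moreover have "z \<in> ring_center R" using central[of "\<one>\<^bsub>R\<^esub>"] zR by simp
    ultimately have "z \<in> prime_radical R"
      \<comment> \<open>\<open>zR\<close> supplies the carrier part of \<open>prime_radical\<close>,
        which is all that remains when there are no prime ideals.\<close>
      using zR square_zero_center_in_prime_ideal by (auto simp: prime_radical_def)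
    then show "b \<otimes>\<^bsub>R\<^esub> a \<otimes>\<^bsub>R\<^esub> c \<in> prime_radical R" by (simp add: z_def)
  qed
qed

end
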